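(* Fix integers $t\ge2$, $k\ge1$, and $q\ge1$. Let $H_{t,k,q}$ be the labelled multihypergraph with vertex set $V$, $|V|=t$, and exactly $k+q$ labelled hyperedge occurrences, each with support equal to $V$. Then $H_{t,k,q}$ is $k$-weakly-partition-connected and has no $k$-distinguishable tree assignment. Moreover, the componentwise-minimal parameter triple among those allowed is $(t,k,q)=(2,1,1)$; it yields the two-vertex hypergraph with two parallel labelled $2$-element hyperedges.
   Context: A labelled multihypergraph $H=(V,E)$ has a finite vertex set $V$ and a finite set $E$ of hyperedge occurrences, each with a support that is a subset of $V$; distinct occurrences may have the same support and remain distinct. We write $e$ both for the occurrence and its support. For a partition $\mathcal P$ of $V$ let $p_{\mathcal P}(e)$ be the number of blocks of $\mathcal P$ met by $e$, and $w_H(\mathcal P)=\sum_{e\in E}(p_{\mathcal P}(e)-1)$. $H$ is $k$-weakly-partition-connected if $w_H(\mathcal P)\ge k(|\mathcal P|-1)$ for every partition $\mathcal P$ of $V$. A tree assignment of $H$ chooses, for every $e\in E$, a simple tree $F_e$ with vertex set $e$ and labels every edge of $F_e$ by $e$; the assigned graph is the labelled multigraph $G=\biguplus_{e\in E}F_e$ on $V$ (disjoint union of labelled edge occurrences; parallel edges may arise only from distinct labels). An ordered $k$-tree decomposition of a labelled graph $G$ on $V$ is an ordered partition $E(G)=E(T_0)\,\dot\cup\,\cdots\,\dot\cup\,E(T_{k-1})$ of all edge occurrences in which every $T_i$ is a spanning tree of $V$ (containing no parallel pair). Its signature is the vector indexed by $e\in E$ with $\mathrm{sig}_{\mathcal T}(e)=\sum_{i=0}^{k-1}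 i\,|E(T_i)\cap E(F_e)|$. The assignment $G$ is $k$-distinguishable if it has an ordered $k$-tree decomposition $\mathcal T$ such that every ordered $k$-tree decomposition $\mathcal T'$ of $G$ with $\mathrm{sig}_{\mathcal T'}=\mathrm{sig}_{\mathcal T}$ equals $\mathcal T$. *)

theory Defs
  imports Main "HOL-Library.Disjoint_Sets" "HOL-Library.Product_Order"
begin

section \<open>Labelled multihypergraphs\<close>

text \<open>
  Hyperedge occurrences are elements of an arbitrary label type; distinct labels may have the
  same support.
\<close>

record ('v, 'e) multihypergraph =
  verts :: "'v set"
  hedges :: "'e set"
  supp :: "'e \<Rightarrow> 'v set"

definition multihypergraph :: "('v, 'e) multihypergraph \<Rightarrow> bool" where
  "multihypergraph H \<longleftrightarrow>
     finite (verts H) \<and> finite (hedges H) \<and> (\<forall>e\<in>hedges H. supp H e \<subseteq> verts H)"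

definition blocks_met :: "'v set set \<Rightarrow> 'v set \<Rightarrow> nat" where
  "blocks_met P X = card {B \<in> P. B \<inter> X \<noteq> {}}"

text \<open>Integer-valued, so that neither subtraction below is truncated.\<close>

definition partition_weight :: "('v, 'e) multihypergraph \<Rightarrow> 'v set set \<Rightarrow> int" where
  "partition_weight H P = (\<Sum>e\<in>hedges H. int (blocks_met P (supp H e)) - 1)"

definition weakly_partition_connected :: "nat \<Rightarrow> ('v, 'e) multihypergraph \<Rightarrow> bool" where
  "weakly_partition_connected k H \<longleftrightarrow>
     (\<forall>P. partition_on (verts H) P \<longrightarrow> partition_weight H P \<ge> int k * (int (card P) - 1))"


section \<open>Trees\<close>

text \<open>
  A simple undirected graph on \<open>V\<close> is given by its set of edges, which are two-element subsets
  of \<open>V\<close>.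
\<close>

definition simple_graph_on :: "'v set \<Rightarrow> 'v set set \<Rightarrow> bool" where
  "simple_graph_on V A \<longleftrightarrow> (\<forall>f\<in>A. f \<subseteq> V \<and> card f = 2)"

definition graph_connected :: "'v set \<Rightarrow> 'v set set \<Rightarrow> bool" where
  "graph_connected V A \<longleftrightarrow>
     V \<noteq> {} \<and> (\<forall>u\<in>V. \<forall>v\<in>V. (u, v) \<in> {(x, y). {x, y} \<in> A}\<^sup>*)"

definition graph_cycle :: "'v set set \<Rightarrow> 'v list \<Rightarrow> bool" where
  "graph_cycle A xs \<longleftrightarrow>
     3 \<le> length xs \<and> distinct xs \<and>
     (\<forall>i<length xs. {xs ! i, xs ! (Suc i mod length xs)} \<in> A)"

definition simple_tree :: "'v set \<Rightarrow> 'v set set \<Rightarrow> bool" where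
  "simple_tree V A \<longleftrightarrow>
     simple_graph_on V A \<and> graph_connected V A \<and> \<not> (\<exists>xs. graph_cycle A xs)"


section \<open>Tree assignments and ordered tree decompositions\<close>

definition tree_assignment :: "('v, 'e) multihypergraph \<Rightarrow> ('e \<Rightarrow> 'v set set) \<Rightarrow> bool" where
  "tree_assignment H F \<longleftrightarrow> (\<forall>e\<in>hedges H. simple_tree (supp H e) (F e))"

text \<open>
  An edge occurrence of a labelled multigraph is a pair of a label and a pair of endpoints, so
  that parallel occurrences are exactly those differing only in the label.
\<close>

type_synonym ('v, 'e) labelled_graph = "('e \<times> 'v set) set"

definition labelled_tree :: "('e \<Rightarrow> 'v set set) \<Rightarrow> 'e \<Rightarrow> ('v, 'e) labelled_graph" where
  "labelled_tree F e = {e} \<times> F e"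

definition assigned_graph ::
    "('v, 'e) multihypergraph \<Rightarrow> ('e \<Rightarrow> 'v set set) \<Rightarrow> ('v, 'e) labelled_graph" where
  "assigned_graph H F = (\<Union>e\<in>hedges H. labelled_tree F e)"

text \<open>The injectivity condition says that no two occurrences in \<open>T\<close> are parallel.\<close>

definition labelled_spanning_tree :: "'v set \<Rightarrow> ('v, 'e) labelled_graph \<Rightarrow> bool" where
  "labelled_spanning_tree V T \<longleftrightarrow> inj_on snd T \<and> simple_tree V (snd ` T)"

definition tree_decomposition ::
    "'v set \<Rightarrow> nat \<Rightarrow> ('v, 'e) labelled_graph \<Rightarrow> ('v, 'e) labelled_graph list \<Rightarrow> bool" where
  "tree_decomposition V k G Ts \<longleftrightarrow>
     length Ts = k \<and>
     (\<Union>i<k. Ts ! i) = G \<and>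
     disjoint_family_on (\<lambda>i. Ts ! i) {..<k} \<and>
     (\<forall>i<k. labelled_spanning_tree V (Ts ! i))"

definition signature ::
    "('e \<Rightarrow> 'v set set) \<Rightarrow> ('v, 'e) labelled_graph list \<Rightarrow> 'e \<Rightarrow> nat" where
  "signature F Ts e = (\<Sum>i<length Ts. i * card (Ts ! i \<inter> labelled_tree F e))"

definition distinguishable ::
    "nat \<Rightarrow> ('v, 'e) multihypergraph \<Rightarrow> ('e \<Rightarrow> 'v set set) \<Rightarrow> bool" where
  "distinguishable k H F \<longleftrightarrow>
     (\<exists>Ts. tree_decomposition (verts H) k (assigned_graph H F) Ts \<and>
       (\<forall>Ts'. tree_decomposition (verts H) k (assigned_graph H F) Ts' \<and>
              (\<forall>e\<in>hedges H. signature F Ts' e = signature F Ts e) \<longrightarrow> Ts' = Ts))"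


section \<open>The hypergraphs $H_{t,k,q}$\<close>

text \<open>
  \<open>H\<close> is a copy of $H_{t,k,q}$, on arbitrary vertices and with arbitrary labels.
\<close>

definition is_H :: "nat \<Rightarrow> nat \<Rightarrow> nat \<Rightarrow> ('v, 'e) multihypergraph \<Rightarrow> bool" where
  "is_H t k q H \<longleftrightarrow>
     multihypergraph H \<and> card (verts H) = t \<and> card (hedges H) = k + q \<and>
     (\<forall>e\<in>hedges H. supp H e = verts H)"

lemma is_H_I:
  assumes "finite V" "card V = t" "finite E" "card E = k + q"
  shows "is_H t k q \<lparr>verts = V, hedges = E, supp = (\<lambda>_. V)\<rparr>"
  using assms by (simp add: is_H_def multihypergraph_def)

definition admissible :: "(nat \<times> nat \<times> nat) set" where
  "admissible = {(t, k, q). 2 \<le> t \<and> 1 \<le> k \<and> 1 \<le> q}"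

end

theory Submission
  imports Defs
begin

text \<open>
  Every block of a partition of \<open>V\<close> meets an edge whose support is all of \<open>V\<close>, so the \<open>k + q\<close>
  full edges give a partition with \<open>m\<close> blocks the weight \<open>(k + q) * (m - 1)\<close>, which is at least
  \<open>k * (m - 1)\<close>.

  Distinguishability fails for the crudest reason: there is no ordered decomposition into \<open>k\<close>
  trees at all.  A tree assignment puts a spanning tree on each of the \<open>k + q\<close> edges, so the
  assigned graph has \<open>(k + q) * (t - 1)\<close> edge occurrences, whereas \<open>k\<close> spanning trees contain
  only \<open>k * (t - 1)\<close> of them, which is fewer as \<open>q > 0\<close> and \<open>t > 1\<close>.

  The substance is therefore the edge count of a tree (\<open>simple_tree_card\<close>).  Acyclicity bounds
  the count from above, by removing leaves one at a time (\<open>forest_card_le\<close>), and connectedness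
  bounds it from below, by sending each vertex other than a root to an edge that leads towards the
  root (\<open>connected_card_ge\<close>).
\<close>

text \<open>
  One end of a longest path is a leaf: any further neighbour of that end either prolongs the path
  or lies on it and closes a cycle.
\<close>

lemma forest_has_leaf:
  assumes V: "finite V" and simple: "simple_graph_on V A"
    and acyclic: "\<not> (\<exists>xs. graph_cycle A xs)" and "A \<noteq> {}"
  shows "\<exists>x\<in>V. \<exists>f. {g \<in> A. x \<in> g} = {f}"
proof -
  define path where
    "path xs \<longleftrightarrow> distinct xs \<and> set xs \<subseteq> V \<and> successively (\<lambda>x y. {x, y} \<in> A) xs" for xs
  have edge: "\<exists>z. z \<noteq> x \<and> z \<in> V \<and> g = {x, z}" if "g \<in> A" "x \<in> g" for g x
  proof -
    have "g \<subseteq> V" "card g = 2"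
      using simple that(1) by (auto simp: simple_graph_on_def)
    then obtain a b where "g = {a, b}" "a \<noteq> b"
      by (meson card_2_iff)
    with that(2) \<open>g \<subseteq> V\<close> show ?thesis by auto
  qed
  obtain g\<^sub>0 where "g\<^sub>0 \<in> A" using \<open>A \<noteq> {}\<close> by auto
  have "g\<^sub>0 \<noteq> {}"
    using \<open>g\<^sub>0 \<in> A\<close> simple by (auto simp: simple_graph_on_def)
  then obtain u where "u \<in> g\<^sub>0" by auto
  with edge[OF \<open>g\<^sub>0 \<in> A\<close>] obtain v where v: "v \<noteq> u" "v \<in> V" "g\<^sub>0 = {u, v}" by blast
  have "u \<in> V"
    using \<open>u \<in> g\<^sub>0\<close> \<open>g\<^sub>0 \<in> A\<close> simple by (auto simp: simple_graph_on_def)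
  have path0: "path [u, v]"
    using v \<open>u \<in> V\<close> \<open>g\<^sub>0 \<in> A\<close> by (simp add: path_def)
  have "length xs < Suc (card V)" if "path xs" for xs
    using that V unfolding path_def
    by (metis card_mono distinct_card less_Suc_eq_le)
  with path0 obtain xs where xs: "path xs" and longest: "\<And>ys. path ys \<Longrightarrow> length ys \<le> length xs"
    using ex_has_greatest_nat[of path "[u, v]" length "Suc (card V)"] by auto
  have "2 \<le> length xs" using longest[OF path0] by simp
  then obtain x y zs where xs_eq: "xs = x # y # zs"
    by (metis One_nat_def Suc_1 Suc_le_length_iff)
  have "g = {x, y}" if g: "g \<in> A" "x \<in> g" for g
  proof -
    from edge[OF g] obtain z where z: "z \<noteq> x" "z \<in> V" "g = {x, z}" by blast
    have "z \<in> set xs"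
    proof (rule ccontr)
      assume "z \<notin> set xs"
      then have "path (z # xs)"
        using xs z g by (auto simp: path_def xs_eq insert_commute)
      from longest[OF this] show False by simp
    qed
    then obtain j where j: "j < length xs" "xs ! j = z"
      by (meson in_set_conv_nth)
    have "j \<noteq> 0" using j z xs_eq by (cases j) auto
    have "j = 1"
    proof (rule ccontr)
      assume "j \<noteq> 1"
      with \<open>j \<noteq> 0\<close> have "2 \<le> j" by simp
      \<comment> \<open>The path up to \<open>z\<close> together with the edge \<open>g\<close> back to \<open>x\<close> is a cycle.\<close>
      define c where "c = take (Suc j) xs"
      have len: "length c = Suc j" using j by (simp add: c_def)
      have "{c ! i, c ! (Suc i mod length c)} \<in> A" if "i < length c" for i
      proof (cases "i = j")
        case True
        have "c ! j = z" "c ! 0 = x" using j(2) by (simp_all add: c_def) (simp add: xs_eq)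
        with True len z g show ?thesis by (simp add: insert_commute)
      next
        case False
        then have "Suc i < length c" using that len by simp
        moreover have "{xs ! i, xs ! Suc i} \<in> A"
          using xs \<open>Suc i < length c\<close> len j(1)
          by (auto simp: path_def successively_conv_nth)
        ultimately show ?thesis using len by (simp add: c_def)
      qed
      then have "graph_cycle A c"
        using len \<open>2 \<le> j\<close> xs by (simp add: graph_cycle_def path_def c_def)
      with acyclic show False by blast
    qed
    with j z xs_eq show ?thesis by simp
  qed
  moreover have "{x, y} \<in> A" "x \<in> V"
    using xs by (auto simp: path_def xs_eq)
  ultimately have "{g \<in> A. x \<in> g} = {{x, y}}" by blast
  with \<open>x \<in> V\<close> show ?thesis by blast
qed

text \<open>
  Deleting a leaf together with its edge keeps a forest acyclic and lowers both counts by one.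
\<close>

lemma forest_card_le:
  assumes "finite V" "V \<noteq> {}" "simple_graph_on V A" "\<not> (\<exists>xs. graph_cycle A xs)"
  shows "card A + 1 \<le> card V"
  using assms
proof (induction "card V" arbitrary: V A rule: less_induct)
  case less
  show ?case
  proof (cases "A = {}")
    case True
    then show ?thesis using less.prems by (simp add: Suc_le_eq card_gt_0_iff)
  next
    case False
    with forest_has_leaf less.prems obtain x f
      where x: "x \<in> V" and f: "{g \<in> A. x \<in> g} = {f}" by metis
    have "f \<in> A" using f by auto
    have no_x: "x \<notin> g" if "g \<in> A - {f}" for g using f that by blast
    have "f \<subseteq> V" "card f = 2"
      using less.prems(3) \<open>f \<in> A\<close> by (auto simp: simple_graph_on_def)
    have "finite A"
      using less.prems(1,3) by (intro finite_subset[of A "Pow V"]) (auto simp: simple_graph_on_def)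
    have "card V \<ge> 2"
      using \<open>f \<subseteq> V\<close> \<open>card f = 2\<close> less.prems(1) by (metis card_mono)
    then have cV: "card V = Suc (card (V - {x}))" "card (V - {x}) > 0"
      using x less.prems(1) by auto
    have "card (A - {f}) + 1 \<le> card (V - {x})"
    proof (rule less.hyps)
      show "card (V - {x}) < card V" "finite (V - {x})" using cV less.prems(1) by auto
      show "V - {x} \<noteq> {}" using cV(2) by (metis card.empty less_irrefl)
      show "simple_graph_on (V - {x}) (A - {f})"
        using less.prems(3) no_x unfolding simple_graph_on_def by blast
      show "\<not> (\<exists>xs. graph_cycle (A - {f}) xs)"
        using less.prems(4) by (auto simp: graph_cycle_def)
    qed
    moreover have "card A = Suc (card (A - {f}))"
      using \<open>finite A\<close> \<open>f \<in> A\<close> by (simp only: card_Suc_Diff1)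
    ultimately show ?thesis using cV by simp
  qed
qed

text \<open>
  Fix a root and choose, for every other vertex, an edge to a vertex nearer to the root.  Distinct
  vertices choose distinct edges, since an edge chosen from both of its ends would have each end
  nearer to the root than the other.
\<close>

lemma connected_card_ge:
  assumes "finite V" "graph_connected V A" "finite A"
  shows "card V \<le> card A + 1"
proof -
  define R where "R = {(x, y). {x, y} \<in> A}"
  obtain r where r: "r \<in> V" using assms(2) by (auto simp: graph_connected_def)
  define d where "d v = (LEAST n. (r, v) \<in> R ^^ n)" for v
  have "\<exists>p. {p, v} \<in> A \<and> d p < d v" if v: "v \<in> V - {r}" for v
  proof -
    have "(r, v) \<in> R\<^sup>*"
      using assms(2) r v by (auto simp: graph_connected_def R_def)
    then have dv: "(r, v) \<in> R ^^ d v"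
      unfolding d_def by (metis LeastI rtrancl_imp_relpow)
    with v have "d v \<noteq> 0" by (metis DiffE insertI1 relpow_0_E)
    then obtain n where n: "d v = Suc n" by (cases "d v") auto
    with dv obtain p where p: "(r, p) \<in> R ^^ n" "(p, v) \<in> R" by auto
    then have "d p \<le> n" by (simp add: d_def Least_le)
    with n p(2) show ?thesis by (auto simp: R_def)
  qed
  then obtain p where p: "\<And>v. v \<in> V - {r} \<Longrightarrow> {p v, v} \<in> A \<and> d (p v) < d v"
    by metis
  have "inj_on (\<lambda>v. {p v, v}) (V - {r})"
  proof (rule inj_onI, rule ccontr)
    fix v w assume vw: "v \<in> V - {r}" "w \<in> V - {r}" "{p v, v} = {p w, w}" "v \<noteq> w"
    then have "p v = w" "p w = v" by (auto simp: doubleton_eq_iff)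
    with p[OF vw(1)] p[OF vw(2)] show False by simp
  qed
  then have "card (V - {r}) \<le> card A"
    using p assms(3) by (intro card_inj_on_le) auto
  then show ?thesis using r assms(1) by simp
qed

lemma simple_tree_card:
  assumes "finite V" "simple_tree V A"
  shows "finite A" and "card A + 1 = card V"
proof -
  show fin: "finite A"
    using assms by (intro finite_subset[of A "Pow V"]) (auto simp: simple_tree_def simple_graph_on_def)
  have "V \<noteq> {}" using assms(2) by (simp add: simple_tree_def graph_connected_def)
  then show "card A + 1 = card V"
    using forest_card_le[of V A] connected_card_ge[of V A] assms fin
    by (simp add: simple_tree_def)
qed

lemma assigned_graph_card:
  assumes "finite V" "finite (hedges H)" "\<forall>e\<in>hedges H. supp H e = V" "tree_assignment H F"
  shows "card (assigned_graph H F) = card (hedges H) * (card V - 1)"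
proof -
  have tree: "finite (F e)" "card (F e) = card V - 1" if "e \<in> hedges H" for e
    using simple_tree_card[of V "F e"] assms that by (auto simp: tree_assignment_def)
  have "assigned_graph H F = (SIGMA e : hedges H. F e)"
    by (auto simp: assigned_graph_def labelled_tree_def)
  then show ?thesis
    using tree assms(2) by simp
qed

lemma tree_decomposition_card:
  assumes "finite V" "tree_decomposition V k G Ts"
  shows "card G = k * (card V - 1)"
proof -
  have G: "G = (\<Union>i<k. Ts ! i)" and disj: "disjoint_family_on (\<lambda>i. Ts ! i) {..<k}"
    and span: "\<forall>i<k. labelled_spanning_tree V (Ts ! i)"
    using assms(2) by (auto simp: tree_decomposition_def)
  have tree: "finite (Ts ! i)" "card (Ts ! i) = card V - 1" if "i < k" for i
  proof -
    have inj: "inj_on snd (Ts ! i)" and "simple_tree V (snd ` (Ts ! i))"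
      using span that by (auto simp: labelled_spanning_tree_def)
    then have "finite (snd ` (Ts ! i))" "card (snd ` (Ts ! i)) + 1 = card V"
      using simple_tree_card assms(1) by blast+
    with inj show "finite (Ts ! i)" "card (Ts ! i) = card V - 1"
      by (auto simp: card_image dest: finite_imageD)
  qed
  have "card G = (\<Sum>i<k. card (Ts ! i))"
    unfolding G using tree disj by (intro card_UN_disjoint) (auto simp: disjoint_family_on_def)
  then show ?thesis using tree by simp
qed

lemma full_edges_weakly_partition_connected:
  assumes "finite (verts H)" "verts H \<noteq> {}" "k \<le> card (hedges H)"
    and full: "\<forall>e\<in>hedges H. supp H e = verts H"
  shows "weakly_partition_connected k H"
  unfolding weakly_partition_connected_def
proof (intro allI impI)
  fix P assume P: "partition_on (verts H) P"
  have union: "\<Union> P = verts H" and "{} \<notin> P"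
    using P by (simp_all add: partition_on_def)
  then have "B \<inter> verts H \<noteq> {}" if "B \<in> P" for B
    using that by (metis Int_absorb2 Union_upper)
  then have "{B \<in> P. B \<inter> verts H \<noteq> {}} = P"
    by blast
  then have "partition_weight H P = int (card (hedges H)) * (int (card P) - 1)"
    using full by (simp add: partition_weight_def blocks_met_def)
  moreover have "finite P"
    using finite_elements[OF assms(1) P] .
  moreover have "P \<noteq> {}"
    using union assms(2) by auto
  ultimately have weight: "partition_weight H P = int (card (hedges H)) * (int (card P) - 1)"
    and "card P > 0"
    by (simp_all add: card_gt_0_iff)
  then have "int (card P) - 1 \<ge> 0"
    by linarith
  then show "partition_weight H P \<ge> int k * (int (card P) - 1)"
    unfolding weight using assms(3) by (simp add: mult_right_mono)
qed

lemma no_tree_decomposition: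
  assumes "is_H t k q H" "t \<ge> 2" "q \<ge> 1" "tree_assignment H F"
  shows "\<not> tree_decomposition (verts H) k (assigned_graph H F) Ts"
proof
  assume "tree_decomposition (verts H) k (assigned_graph H F) Ts"
  moreover have H: "finite (verts H)" "finite (hedges H)" "card (verts H) = t"
      "card (hedges H) = k + q" "\<forall>e\<in>hedges H. supp H e = verts H"
    using assms(1) by (auto simp: is_H_def multihypergraph_def)
  ultimately have "k * (t - 1) = (k + q) * (t - 1)"
    using tree_decomposition_card assigned_graph_card[OF H(1,2,5) assms(4)] by metis
  with assms(2,3) show False by simp
qed

lemma is_H_2_1_1_iff:
  "is_H 2 1 1 H \<longleftrightarrow>
    (\<exists>x y a b. x \<noteq> y \<and> a \<noteq> b \<and> verts H = {x, y} \<and> hedges H = {a, b} \<and>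
       supp H a = {x, y} \<and> supp H b = {x, y})"
  (is "?L \<longleftrightarrow> ?R")
proof
  assume L: ?L
  then have "card (verts H) = 2" "card (hedges H) = 2"
    by (auto simp: is_H_def)
  then obtain x y a b where "verts H = {x, y}" "x \<noteq> y" "hedges H = {a, b}" "a \<noteq> b"
    by (meson card_2_iff)
  with L show ?R by (auto simp: is_H_def)
next
  assume ?R
  then show ?L by (auto simp: is_H_def multihypergraph_def)
qed

theorem theorem1p3:
  shows "(\<forall>t k q. \<forall>H :: ('v, 'e) multihypergraph.
            t \<ge> 2 \<and> k \<ge> 1 \<and> q \<ge> 1 \<and> is_H t k q H \<longrightarrow>
              weakly_partition_connected k H \<and>
              \<not> (\<exists>F. tree_assignment H F \<and> distinguishable k H F))
       \<and> {p \<in> admissible. \<forall>r\<in>admissible. r \<le> p \<longrightarrow> r = p} = {(2, 1, 1)}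
       \<and> (\<forall>p\<in>admissible. (2, 1, 1) \<le> p)
       \<and> (\<forall>H :: ('v, 'e) multihypergraph.
            is_H 2 1 1 H \<longleftrightarrow>
              (\<exists>x y a b. x \<noteq> y \<and> a \<noteq> b \<and> verts H = {x, y} \<and> hedges H = {a, b} \<and>
                 supp H a = {x, y} \<and> supp H b = {x, y}))"
proof (intro conjI)
  show "\<forall>t k q. \<forall>H :: ('v, 'e) multihypergraph.
            t \<ge> 2 \<and> k \<ge> 1 \<and> q \<ge> 1 \<and> is_H t k q H \<longrightarrow>
              weakly_partition_connected k H \<and>
              \<not> (\<exists>F. tree_assignment H F \<and> distinguishable k H F)"
  proof (intro allI impI, elim conjE, intro conjI)
    fix t k q and H :: "('v, 'e) multihypergraph"
    assume t: "t \<ge> 2" and q: "q \<ge> 1" and H: "is_H t k q H"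
    show "weakly_partition_connected k H"
      using H t by (intro full_edges_weakly_partition_connected)
        (auto simp: is_H_def multihypergraph_def)
    show "\<not> (\<exists>F. tree_assignment H F \<and> distinguishable k H F)"
      using no_tree_decomposition[OF H t q] by (auto simp: distinguishable_def)
  qed
  show least: "\<forall>p\<in>admissible. (2, 1, 1) \<le> p"
    by (auto simp: admissible_def)
  have "(2, 1, 1) \<in> admissible" by (simp add: admissible_def)
  with least show "{p \<in> admissible. \<forall>r\<in>admissible. r \<le> p \<longrightarrow> r = p} = {(2, 1, 1)}"
    by (blast intro: antisym)
  show "\<forall>H :: ('v, 'e) multihypergraph.
            is_H 2 1 1 H \<longleftrightarrow>
              (\<exists>x y a b. x \<noteq> y \<and> a \<noteq> b \<and> verts H = {x, y} \<and> hedges H = {a, b} \<and>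
                 supp H a = {x, y} \<and> supp H b = {x, y})"
    by (rule allI, rule is_H_2_1_1_iff)
qed

end
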